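(* $f(4,3)=f(5,3)=2$. For every integer $n\ge 3$ with $n\notin\{4,5\}$, $f(n,3)=\lfloor n/6\rfloor+1$.
   Context: $K_n$ denotes the complete graph on $n$ vertices. For a $k$-edge coloring $c:E(K_n)\to\{1,\ldots,k\}$ (an arbitrary map, not necessarily proper), let $f(K_n,c)$ be the minimum, over the colors $i\in\{1,\ldots,k\}$, of the number of connected components of the subgraph induced by the edges of color $i$; this subgraph consists of the edges of color $i$ and their endpoints, so isolated vertices are not counted as components (an unused color has $0$ components). $f(n,k)$ is the maximum of $f(K_n,c)$ over all $k$-edge colorings $c$ of $K_n$. It is always assumed that $k\le e(K_n)=\binom{n}{2}$. *)

theory Defs
  imports Main "HOL-Library.FuncSet"
begin

text \<open>Simple graphs are given by a vertex set together with a set of edges, an edge being the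
  two-element set of its endpoints.\<close>

definition complete_edges :: "'a set \<Rightarrow> 'a set set" where
  "complete_edges V = {e. e \<subseteq> V \<and> card e = 2}"

definition adjacency :: "'a set set \<Rightarrow> ('a \<times> 'a) set" where
  "adjacency E = {(u, v). {u, v} \<in> E}"

text \<open>A connected component is represented by its vertex set: the components are the classes of
  the relation ``joined by a path'' on the vertex set.\<close>

definition components :: "'a set \<Rightarrow> 'a set set \<Rightarrow> 'a set set" where
  "components V E = V // Restr ((adjacency E)\<^sup>*) V"

definition color_class :: "'a set set \<Rightarrow> ('a set \<Rightarrow> nat) \<Rightarrow> nat \<Rightarrow> 'a set set" where
  "color_class E c i = {e \<in> E. c e = i}"

text \<open>The vertex set of the subgraph induced by a set \<open>F\<close> of edges is \<open>\<Union>F\<close>, so that no isolated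
  vertices occur and an empty colour class has no components.\<close>

definition num_color_components :: "'a set set \<Rightarrow> ('a set \<Rightarrow> nat) \<Rightarrow> nat \<Rightarrow> nat" where
  "num_color_components E c i = card (components (\<Union>(color_class E c i)) (color_class E c i))"

definition min_color_components :: "'a set set \<Rightarrow> nat \<Rightarrow> ('a set \<Rightarrow> nat) \<Rightarrow> nat" where
  "min_color_components E k c = Min (num_color_components E c ` {1..k})"

text \<open>Colourings are taken to be extensional (\<open>\<rightarrow>\<^sub>E\<close>), so they form a finite set. The definition is
  meaningful for \<open>1 \<le> k\<close>, where both \<open>Min\<close> and \<open>Max\<close> range over finite nonempty sets.\<close>

definition edge_colorings :: "'a set set \<Rightarrow> nat \<Rightarrow> ('a set \<Rightarrow> nat) set" where
  "edge_colorings E k = E \<rightarrow>\<^sub>E {1..k}"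

definition f_max :: "nat \<Rightarrow> nat \<Rightarrow> nat" where
  "f_max n k = Max (min_color_components (complete_edges {..<n}) k `
                  edge_colorings (complete_edges {..<n}) k)"

end

theory Submission
  imports Defs
begin

text \<open>Give every vertex \<open>v\<close> the triple of the components, one for each colour, that contain \<open>v\<close>
  (a vertex isolated in a colour is alone in its class there). Since every edge has a colour, any
  two of these triples agree in some coordinate.

  Upper bound. Suppose that every colour has at least three components, so that each coordinate
  takes at least three values. A family of pairwise agreeing triples of this kind must have a
  centre \<open>(x, y, z)\<close> such that every triple differs from it in at most one coordinate
  (\<open>intersecting_triples_have_centre\<close>). So the sets of vertices outside the component \<open>x\<close>, outside
  \<open>y\<close> and outside \<open>z\<close> are disjoint. If each colour has at least \<open>t\<close> components, each of
  these sets contains \<open>t - 1\<close> components of its colour, of at least two vertices each, and hence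
  \<open>6 (t - 1) \<le> n\<close>. As \<open>t \<ge> 3\<close> thus forces \<open>n \<ge> 12\<close>, the values for \<open>n < 12\<close> come down to whether
  two components per colour are possible; for \<open>n = 3\<close> they are not, since two components occupy four
  vertices.

  Lower bound. The extremal colourings are read off from the centred structure: there are three
  types of vertices, one for each colour, vertices of one type are grouped in pairs joined
  by the colour of that type, and two vertices of different types are joined by the third colour.
  Each colour then has its pairs as components and one more component that contains the two other
  types. For \<open>n = 4\<close> the three perfect matchings of the complete graph do better, and for \<open>n = 5\<close> one
  duplicates a vertex of that colouring. To see that a colouring has many components it suffices to
  exhibit labels of the vertices that are constant along the edges of a colour
  (\<open>card_labels_le_components\<close>).\<close>

section \<open>Component classes\<close>

definition component_of :: "'a set set \<Rightarrow> 'a \<Rightarrow> 'a set" where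
  "component_of F v = (adjacency F)\<^sup>* `` {v}"

lemma component_of_self: "v \<in> component_of F v"
  by (simp add: component_of_def)

lemma component_of_eq:
  assumes "v \<in> component_of F u"
  shows "component_of F v = component_of F u"
proof -
  have "sym (adjacency F)"
    by (auto simp: adjacency_def sym_def insert_commute)
  then have "sym ((adjacency F)\<^sup>*)"
    by (rule sym_rtrancl)
  moreover have uv: "(u, v) \<in> (adjacency F)\<^sup>*"
    using assms by (simp add: component_of_def)
  ultimately have "(v, u) \<in> (adjacency F)\<^sup>*"
    by (rule symD)
  with uv show ?thesis
    by (auto simp: component_of_def intro: rtrancl_trans)
qed

lemma edge_component_of_eq:
  assumes "{u, v} \<in> F"
  shows "component_of F u = component_of F v"
proof -
  have "v \<in> component_of F u"
    using assms by (auto simp: component_of_def adjacency_def)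
  then show ?thesis by (simp add: component_of_eq)
qed

lemma component_of_subset:
  assumes "v \<in> \<Union>F"
  shows "component_of F v \<subseteq> \<Union>F"
proof
  fix w assume "w \<in> component_of F v"
  then have "(v, w) \<in> (adjacency F)\<^sup>*"
    by (simp add: component_of_def)
  then show "w \<in> \<Union>F"
    using assms by (induction rule: rtrancl_induct) (auto simp: adjacency_def)
qed

lemma components_eq_image: "components (\<Union>F) F = component_of F ` \<Union>F"
proof -
  have "Restr ((adjacency F)\<^sup>*) (\<Union>F) `` {v} = component_of F v" if "v \<in> \<Union>F" for v
    using component_of_subset[OF that] that by (auto simp: component_of_def)
  then show ?thesis
    unfolding components_def quotient_def by blast
qed

lemma finite_complete_edges: "finite V \<Longrightarrow> finite (complete_edges V)"
  unfolding complete_edges_def by simp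

lemma Union_subset_vertices: "F \<subseteq> complete_edges V \<Longrightarrow> \<Union>F \<subseteq> V"
  unfolding complete_edges_def by blast

lemma components_card_ge_2:
  assumes "finite V" and F: "F \<subseteq> complete_edges V" and X: "X \<in> components (\<Union>F) F"
  shows "2 \<le> card X"
proof -
  obtain v e where v: "X = component_of F v" "v \<in> e" "e \<in> F"
    using X unfolding components_eq_image by blast
  then have e: "card e = 2"
    using F by (auto simp: complete_edges_def)
  have "X \<subseteq> V"
    using v component_of_subset[of v F] Union_subset_vertices[OF F] by blast
  with \<open>finite V\<close> have "finite X"
    by (rule rev_finite_subset)
  moreover have "e \<subseteq> X"
  proof
    fix w assume "w \<in> e"
    from e obtain a b where "e = {a, b}"
      by (auto simp: card_2_iff)
    with v have "component_of F a = component_of F b" "v \<in> {a, b}"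
      by (simp_all add: edge_component_of_eq)
    with \<open>w \<in> e\<close> \<open>e = {a, b}\<close> v(1) have "component_of F w = X"
      by auto
    then show "w \<in> X"
      using component_of_self[of w F] by simp
  qed
  ultimately have "card e \<le> card X"
    by (rule card_mono)
  then show ?thesis
    using e by simp
qed

text \<open>Components are disjoint and have at least two vertices each. This is used with \<open>W\<close> the complement
  of one component, or all vertices.\<close>

lemma card_components_le:
  assumes "finite V" and F: "F \<subseteq> complete_edges V"
    and "\<C> \<subseteq> components (\<Union>F) F" and W: "\<Union>\<C> \<subseteq> W" "finite W"
  shows "2 * card \<C> \<le> card W"
proof -
  have "pairwise disjnt \<C>"
  proof (rule pairwiseI)
    fix X Y assume XY: "X \<in> \<C>" "Y \<in> \<C>" "X \<noteq> Y"
    from XY(1,2) obtain u v where uv: "X = component_of F u" "Y = component_of F v"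
      using assms(3) unfolding components_eq_image by blast
    show "disjnt X Y"
    proof (rule ccontr)
      assume "\<not> disjnt X Y"
      then obtain w where "w \<in> component_of F u" "w \<in> component_of F v"
        unfolding disjnt_def uv by blast
      then show False
        using component_of_eq[of w F u] component_of_eq[of w F v] XY(3) uv by simp
    qed
  qed
  moreover have "finite X" if "X \<in> \<C>" for X
    using that W by (meson Sup_upper finite_subset)
  ultimately have "card (\<Union>\<C>) = sum card \<C>"
    by (rule card_Union_disjoint)
  moreover have "card \<C> * 2 \<le> sum card \<C>"
    using sum_bounded_below[of \<C> 2 card] components_card_ge_2[OF \<open>finite V\<close> F] assms(3)
    by (auto simp: subset_iff)
  moreover have "card (\<Union>\<C>) \<le> card W"
    using W by (intro card_mono)
  ultimately show ?thesis by simp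
qed

text \<open>Along a path of \<open>F\<close> the label does not change, so each component carries a single label.\<close>

lemma card_labels_le_components:
  assumes "finite (\<Union>F)" and const: "\<And>u v. {u, v} \<in> F \<Longrightarrow> g u = g v"
  shows "card (g ` \<Union>F) \<le> card (components (\<Union>F) F)"
proof -
  have label: "g w = g v" if "w \<in> component_of F v" for v w
  proof -
    have "(v, w) \<in> (adjacency F)\<^sup>*"
      using that by (simp add: component_of_def)
    then show ?thesis
    proof (induction rule: rtrancl_induct)
      case (step a b)
      then show ?case using const[of a b] by (simp add: adjacency_def)
    qed simp
  qed
  have "the_elem (g ` component_of F v) = g v" for v
  proof -
    have "g ` component_of F v = {g v}"
      using label[of _ v] component_of_self[of v F] by blast
    then show ?thesis by simp
  qed
  then have "g ` \<Union>F = (\<lambda>X. the_elem (g ` X)) ` components (\<Union>F) F"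
    by (simp add: components_eq_image image_image)
  then show ?thesis
    using assms(1) by (simp add: components_eq_image card_image_le)
qed

section \<open>Intersecting triples\<close>

text \<open>Any \<open>w\<close> outside the class \<open>p u = p v\<close> has to meet \<open>u\<close> and \<open>v\<close> in different ones of the
  coordinates \<open>q\<close> and \<open>r\<close>. So \<open>(q w, r w)\<close> is either \<open>(q u, r v)\<close> or \<open>(q v, r u)\<close>. These two patterns
  disagree everywhere, so they can occur together only for vertices with the same value of \<open>p\<close>; the
  presence of a further value of \<open>p\<close> then leaves one pattern, and this is the centre.\<close>

lemma centre_of_single_agreement:
  assumes agree: "\<And>u v. \<lbrakk>u \<in> V; v \<in> V\<rbrakk> \<Longrightarrow> p u = p v \<or> q u = q v \<or> r u = r v"
    and three: "\<And>a b. \<exists>w\<in>V. p w \<noteq> a \<and> p w \<noteq> b"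
    and uv: "u \<in> V" "v \<in> V" "p u = p v" "q u \<noteq> q v" "r u \<noteq> r v"
  shows "\<exists>x y z. \<forall>v\<in>V. p v = x \<and> q v = y \<or> p v = x \<and> r v = z \<or> q v = y \<and> r v = z"
proof -
  obtain w where w: "w \<in> V" "p w \<noteq> p u"
    using three by blast
  obtain w' where w': "w' \<in> V" "p w' \<noteq> p u" "p w' \<noteq> p w"
    using three by blast
  have pattern: "q s = q u \<and> r s = r v \<or> q s = q v \<and> r s = r u" if "s \<in> V" "p s \<noteq> p u" for s
    using agree[of s u] agree[of s v] that uv by metis
  \<comment> \<open>If \<open>s\<close> has the same value of \<open>p\<close> as \<open>w\<close>, it is compared with \<open>w'\<close> instead.\<close>
  have same: "q s = q w \<and> r s = r w" if "s \<in> V" "p s \<noteq> p u" for s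
    using pattern[OF that] pattern[OF w] pattern[of w'] w w' uv
      agree[of s w] agree[of s w'] agree[of w w'] that by metis
  have "p s = p u \<and> q s = q w \<or> p s = p u \<and> r s = r w \<or> q s = q w \<and> r s = r w" if "s \<in> V" for s
    using same[OF that] agree[OF that w(1)] w by metis
  then show ?thesis by blast
qed

text \<open>If no two triples agree in exactly one coordinate, all distinct triples differ in exactly
  one; then all of them differ in the same coordinate, and the two other coordinates are
  constant, against the three values that each coordinate takes.\<close>

lemma intersecting_triples_have_centre:
  assumes agree: "\<And>u v. \<lbrakk>u \<in> V; v \<in> V\<rbrakk> \<Longrightarrow> p u = p v \<or> q u = q v \<or> r u = r v"
    and p3: "\<And>a b. \<exists>w\<in>V. p w \<noteq> a \<and> p w \<noteq> b"
    and q3: "\<And>a b. \<exists>w\<in>V. q w \<noteq> a \<and> q w \<noteq> b"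
    and r3: "\<And>a b. \<exists>w\<in>V. r w \<noteq> a \<and> r w \<noteq> b"
  shows "\<exists>x y z. \<forall>v\<in>V. p v = x \<and> q v = y \<or> p v = x \<and> r v = z \<or> q v = y \<and> r v = z"
proof -
  obtain u where u: "u \<in> V"
    using p3 by blast
  obtain v where v: "v \<in> V" "p v \<noteq> p u"
    using p3 by blast
  obtain w where w: "w \<in> V" "q w \<noteq> q u"
    using q3 by blast
  have "\<exists>u\<in>V. \<exists>v\<in>V. p u = p v \<and> q u \<noteq> q v \<and> r u \<noteq> r v \<or> q u = q v \<and> p u \<noteq> p v \<and> r u \<noteq> r v
      \<or> r u = r v \<and> p u \<noteq> p v \<and> q u \<noteq> q v"
    using agree[OF u v(1)] agree[OF u w(1)] agree[OF v(1) w(1)] u v w by metis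
  then obtain u v where "u \<in> V" "v \<in> V" and
    cases: "p u = p v \<and> q u \<noteq> q v \<and> r u \<noteq> r v \<or> q u = q v \<and> p u \<noteq> p v \<and> r u \<noteq> r v
      \<or> r u = r v \<and> p u \<noteq> p v \<and> q u \<noteq> q v"
    by blast
  from cases show ?thesis
  proof (elim disjE)
    assume "p u = p v \<and> q u \<noteq> q v \<and> r u \<noteq> r v"
    then show ?thesis
      using centre_of_single_agreement[of V p q r u v] agree p3 \<open>u \<in> V\<close> \<open>v \<in> V\<close> by blast
  next
    assume "q u = q v \<and> p u \<noteq> p v \<and> r u \<noteq> r v"
    then have "\<exists>y x z. \<forall>v\<in>V. q v = y \<and> p v = x \<or> q v = y \<and> r v = z \<or> p v = x \<and> r v = z"
      using centre_of_single_agreement[of V q p r u v] agree q3 \<open>u \<in> V\<close> \<open>v \<in> V\<close> by blast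
    then show ?thesis by metis
  next
    assume "r u = r v \<and> p u \<noteq> p v \<and> q u \<noteq> q v"
    then have "\<exists>z x y. \<forall>v\<in>V. r v = z \<and> p v = x \<or> r v = z \<and> q v = y \<or> p v = x \<and> q v = y"
      using centre_of_single_agreement[of V r p q u v] agree r3 \<open>u \<in> V\<close> \<open>v \<in> V\<close> by blast
    then show ?thesis by metis
  qed
qed

section \<open>The upper bound\<close>

lemma color_class_subset: "color_class E c i \<subseteq> E"
  unfolding color_class_def by blast

lemma three_components_avoid_two:
  assumes F: "F \<subseteq> complete_edges V"
    and "3 \<le> card (components (\<Union>F) F)"
  shows "\<exists>w\<in>V. component_of F w \<noteq> a \<and> component_of F w \<noteq> b"
proof -
  have "card {a, b} \<le> 2"
    by (simp add: card_insert_if)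
  then have "\<not> components (\<Union>F) F \<subseteq> {a, b}"
    using assms(2) card_mono[of "{a, b}" "components (\<Union>F) F"] by auto
  then show ?thesis
    using Union_subset_vertices[OF F] unfolding components_eq_image by blast
qed

lemma card_outside_component:
  assumes "finite V" and F: "F \<subseteq> complete_edges V"
  shows "2 * (card (components (\<Union>F) F) - 1) \<le> card {v \<in> V. component_of F v \<noteq> x}"
proof -
  have "\<Union>(components (\<Union>F) F - {x}) \<subseteq> {v \<in> V. component_of F v \<noteq> x}"
  proof
    fix v assume "v \<in> \<Union>(components (\<Union>F) F - {x})"
    then obtain u where u: "u \<in> \<Union>F" "component_of F u \<noteq> x" "v \<in> component_of F u"
      unfolding components_eq_image by blast
    then show "v \<in> {v \<in> V. component_of F v \<noteq> x}"
      using component_of_eq[OF u(3)] component_of_subset[OF u(1)] Union_subset_vertices[OF F]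
      by auto
  qed
  then have "2 * card (components (\<Union>F) F - {x}) \<le> card {v \<in> V. component_of F v \<noteq> x}"
    using assms by (intro card_components_le[OF assms]) auto
  then show ?thesis
    by (simp add: card_Diff_singleton_if split: if_splits)
qed

lemma three_colored_component_bound:
  assumes "finite V" and c: "c ` complete_edges V \<subseteq> {1..3}" and "3 \<le> t"
    and many: "\<And>i. i \<in> {1..3} \<Longrightarrow> t \<le> num_color_components (complete_edges V) c i"
  shows "6 * (t - 1) \<le> card V"
proof -
  define F where "F = color_class (complete_edges V) c"
  have F: "F i \<subseteq> complete_edges V" for i
    unfolding F_def by (rule color_class_subset)
  have t: "t \<le> card (components (\<Union>(F i)) (F i))" if "i \<in> {1..3}" for i
    using many[OF that] by (simp add: num_color_components_def F_def)
  define p where "p i = component_of (F i)" for i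
  have agree: "p 1 u = p 1 v \<or> p 2 u = p 2 v \<or> p 3 u = p 3 v" if "u \<in> V" "v \<in> V" for u v
  proof (cases "u = v")
    case False
    with that have e: "{u, v} \<in> complete_edges V"
      by (simp add: complete_edges_def)
    then have "{u, v} \<in> F (c {u, v})"
      by (simp add: F_def color_class_def)
    then have "p (c {u, v}) u = p (c {u, v}) v"
      unfolding p_def by (rule edge_component_of_eq)
    moreover have "c {u, v} \<in> {1..3}"
      using c e by blast
    then have "c {u, v} = 1 \<or> c {u, v} = 2 \<or> c {u, v} = 3"
      by auto
    ultimately show ?thesis by metis
  qed simp
  have three: "\<exists>w\<in>V. p i w \<noteq> a \<and> p i w \<noteq> b" if "i \<in> {1..3}" for i a b
    unfolding p_def using t[OF that] \<open>3 \<le> t\<close>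
    by (intro three_components_avoid_two[OF F]) simp
  have "\<exists>x y z. \<forall>v\<in>V. p 1 v = x \<and> p 2 v = y \<or> p 1 v = x \<and> p 3 v = z \<or> p 2 v = y \<and> p 3 v = z"
    using agree three by (intro intersecting_triples_have_centre) auto
  then obtain x y z where centre:
    "\<forall>v\<in>V. p 1 v = x \<and> p 2 v = y \<or> p 1 v = x \<and> p 3 v = z \<or> p 2 v = y \<and> p 3 v = z"
    by blast
  define B where "B i a = {v \<in> V. p i v \<noteq> a}" for i a
  have B: "2 * (t - 1) \<le> card (B i a)" if "i \<in> {1..3}" for i a
    using card_outside_component[OF \<open>finite V\<close> F, of i a] t[OF that]
    by (simp add: B_def p_def)
  have "card (B 1 x \<union> B 2 y \<union> B 3 z) = card (B 1 x) + card (B 2 y) + card (B 3 z)"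
    using centre \<open>finite V\<close> by (subst card_Un_disjoint; auto simp: B_def card_Un_disjoint)+
  moreover have "card (B 1 x \<union> B 2 y \<union> B 3 z) \<le> card V"
    using \<open>finite V\<close> by (intro card_mono) (auto simp: B_def)
  ultimately show ?thesis
    using B[of 1 x] B[of 2 y] B[of 3 z] by simp
qed

lemma le_f_max_iff:
  "t \<le> f_max n 3 \<longleftrightarrow> (\<exists>c \<in> edge_colorings (complete_edges {..<n}) 3.
      \<forall>i\<in>{1..3}. t \<le> num_color_components (complete_edges {..<n}) c i)"
proof -
  let ?C = "edge_colorings (complete_edges {..<n}) 3"
  have "finite ?C"
    unfolding edge_colorings_def by (intro finite_PiE) (auto simp: finite_complete_edges)
  moreover have "?C \<noteq> {}"
    unfolding edge_colorings_def by (simp add: PiE_eq_empty_iff)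
  ultimately show ?thesis
    unfolding f_max_def min_color_components_def by (simp add: Max_ge_iff)
qed

lemma f_max_upper:
  assumes "3 \<le> f_max n 3"
  shows "6 * (f_max n 3 - 1) \<le> n"
proof -
  obtain c where "c \<in> edge_colorings (complete_edges {..<n}) 3"
    and "\<forall>i\<in>{1..3}. f_max n 3 \<le> num_color_components (complete_edges {..<n}) c i"
    using le_f_max_iff[of "f_max n 3" n] by auto
  then show ?thesis
    using three_colored_component_bound[of "{..<n}" c "f_max n 3"] assms
    by (auto simp: edge_colorings_def)
qed

lemma f_max_le_half: "2 * f_max n 3 \<le> n"
proof -
  obtain c where many: "\<forall>i\<in>{1..3}. f_max n 3 \<le> num_color_components (complete_edges {..<n}) c i"
    using le_f_max_iff[of "f_max n 3" n] by auto
  let ?F = "color_class (complete_edges {..<n}) c 1"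
  have F: "?F \<subseteq> complete_edges {..<n}"
    by (rule color_class_subset)
  have "\<Union>(components (\<Union>?F) ?F) \<subseteq> {..<n}"
    using component_of_subset[of _ ?F] Union_subset_vertices[OF F]
    unfolding components_eq_image by blast
  then have "2 * card (components (\<Union>?F) ?F) \<le> card {..<n}"
    by (intro card_components_le[OF _ F]) auto
  then show ?thesis
    using bspec[OF many, of 1] by (simp add: num_color_components_def)
qed

section \<open>The lower bound\<close>

text \<open>The colours are \<open>0, 1, 2\<close> here, as the constructions compute modulo 3. The map \<open>h\<close> gives the
  colour of the edge between two vertices of which the first is the smaller one, and \<open>g i\<close>
  labels the vertices for colour \<open>i\<close>.\<close>

lemma f_max_lower:
  fixes h :: "nat \<Rightarrow> nat \<Rightarrow> nat" and g :: "nat \<Rightarrow> nat \<Rightarrow> nat"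
  assumes colors: "\<And>u v. \<lbrakk>u < v; v < n\<rbrakk> \<Longrightarrow> h u v < 3"
    and const: "\<And>u v. \<lbrakk>u < v; v < n\<rbrakk> \<Longrightarrow> g (h u v) u = g (h u v) v"
    and labels: "\<And>i a. \<lbrakk>i < 3; a < t\<rbrakk> \<Longrightarrow> \<exists>u v. u < v \<and> v < n \<and> h u v = i \<and> g i u = a"
  shows "t \<le> f_max n 3"
proof -
  let ?E = "complete_edges {..<n}"
  define c where "c = restrict (\<lambda>e. Suc (h (Min e) (Max e))) ?E"
  have cE: "c {u, v} = Suc (h u v)" "{u, v} \<in> ?E" if "u < v" "v < n" for u v
    using that by (auto simp: c_def complete_edges_def)
  have edge: "\<exists>u v. u < v \<and> v < n \<and> e = {u, v}" if "e \<in> ?E" for e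
  proof -
    from that obtain a b where "e = {a, b}" "a \<noteq> b" "a < n" "b < n"
      by (auto simp: complete_edges_def card_2_iff)
    then show ?thesis
      by (metis insert_commute nat_neq_iff)
  qed
  have "c e \<in> {1..3}" if "e \<in> ?E" for e
    using edge[OF that] colors by (force simp: cE)
  then have "c \<in> edge_colorings ?E 3"
    by (auto simp: edge_colorings_def c_def)
  moreover have "t \<le> num_color_components ?E c i" if i: "i \<in> {1..3}" for i
  proof -
    obtain j where j: "i = Suc j" "j < 3"
      using i by (cases i) auto
    let ?F = "color_class ?E c i"
    have fin: "finite (\<Union>?F)"
      using Union_subset_vertices[OF color_class_subset] by (rule finite_subset) simp
    have "{..<t} \<subseteq> g j ` \<Union>?F"
    proof
      fix a assume "a \<in> {..<t}"
      then obtain u v where "u < v" "v < n" "h u v = j" "g j u = a"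
        using labels j by blast
      moreover from this have "{u, v} \<in> ?F"
        using cE j by (simp add: color_class_def)
      ultimately show "a \<in> g j ` \<Union>?F" by blast
    qed
    then have "card {..<t} \<le> card (g j ` \<Union>?F)"
      by (intro card_mono finite_imageI fin)
    also have "\<dots> \<le> card (components (\<Union>?F) ?F)"
    proof (rule card_labels_le_components[OF fin])
      fix u v assume uv: "{u, v} \<in> ?F"
      then have "u \<noteq> v" "u < n" "v < n"
        by (auto simp: color_class_def complete_edges_def)
      moreover have "g j u = g j v" if "u < v" "v < n" "{u, v} \<in> ?F" for u v
        using that const[of u v] cE[of u v] j by (auto simp: color_class_def)
      ultimately show "g j u = g j v"
        using uv by (metis insert_commute nat_neq_iff)
    qed
    finally show ?thesis
      by (simp add: num_color_components_def)
  qed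
  ultimately show ?thesis
    unfolding le_f_max_iff by blast
qed

text \<open>The type of a vertex is its residue modulo 3, so each block of six consecutive numbers
  contains one pair of every type; the last, incomplete block may leave vertices without partner,
  which does no harm. Two vertices of the same type \<open>a\<close> in different blocks may get any colour but \<open>a\<close>.
  For colour \<open>i\<close>, the vertices of the two other types get the label \<open>0\<close>.\<close>

lemma f_max_lower_general:
  assumes "3 \<le> n"
  shows "n div 6 + 1 \<le> f_max n 3"
proof -
  define h where "h u v = (if u mod 3 \<noteq> v mod 3 then 3 - u mod 3 - v mod 3
      else if u div 6 = v div 6 then u mod 3 else Suc u mod 3)" for u v :: nat
  define g where "g i v = (if v mod 3 = i then Suc (v div 6) else 0)" for i v :: nat
  show ?thesis
  proof (rule f_max_lower[of n h g])
    fix u v :: nat assume "u < v" "v < n"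
    have "u mod 3 < 3" "v mod 3 < 3" by simp_all
    then show "h u v < 3" unfolding h_def by auto
    show "g (h u v) u = g (h u v) v"
    proof (cases "u mod 3 = v mod 3")
      case True
      moreover have "Suc u mod 3 \<noteq> u mod 3" by presburger
      ultimately show ?thesis by (auto simp: h_def g_def)
    next
      case False
      have "3 - a - b \<noteq> a \<and> 3 - a - b \<noteq> b" if "a < 3" "b < 3" "a \<noteq> b" for a b :: nat
        using that by presburger
      then have "3 - u mod 3 - v mod 3 \<noteq> u mod 3 \<and> 3 - u mod 3 - v mod 3 \<noteq> v mod 3"
        using False \<open>u mod 3 < 3\<close> \<open>v mod 3 < 3\<close> by blast
      then show ?thesis
        using False by (auto simp: h_def g_def)
    qed
  next
    fix i a :: nat assume i: "i < 3" and a: "a < n div 6 + 1"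
    show "\<exists>u v. u < v \<and> v < n \<and> h u v = i \<and> g i u = a"
    proof (cases a)
      case 0
      from i consider "i = 0" | "i = 1" | "i = 2" by linarith
      then show ?thesis
      proof cases
        case 1
        then have "1 < (2::nat) \<and> 2 < n \<and> h 1 2 = i \<and> g i 1 = a"
          using 0 assms by (auto simp: h_def g_def)
        then show ?thesis by blast
      next
        case 2
        then have "0 < (2::nat) \<and> 2 < n \<and> h 0 2 = i \<and> g i 0 = a"
          using 0 assms by (auto simp: h_def g_def)
        then show ?thesis by blast
      next
        case 3
        then have "0 < (1::nat) \<and> 1 < n \<and> h 0 1 = i \<and> g i 0 = a"
          using 0 assms by (auto simp: h_def g_def)
        then show ?thesis by blast
      qed
    next
      case (Suc q)
      with a have "6 * q + 6 \<le> n" by linarith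
      moreover have "(6 * q + i) mod 3 = i" "(6 * q + 3 + i) mod 3 = i"
        "(6 * q + i) div 6 = q" "(6 * q + 3 + i) div 6 = q"
        using i by presburger+
      ultimately have "6 * q + i < 6 * q + 3 + i \<and> 6 * q + 3 + i < n
          \<and> h (6 * q + i) (6 * q + 3 + i) = i \<and> g i (6 * q + i) = a"
        using i Suc by (simp add: h_def g_def)
      then show ?thesis by blast
    qed
  qed
qed

text \<open>The labels of a vertex are its two last binary digits and their sum modulo 2, so two vertices
  that differ in both digits agree in the sum. On \<open>{0, 1, 2, 3}\<close>, each \<open>g i\<close> tells the two edges of
  one perfect matching apart. The vertex \<open>4\<close> has the same labels as \<open>0\<close>, and the edge between these
  two gets colour \<open>0\<close>.\<close>

lemma f_max_lower_4_5:
  assumes "n = 4 \<or> n = 5"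
  shows "2 \<le> f_max n 3"
proof -
  define g where "g i v = (if i = 0 then v div 2 mod 2 else if i = 1 then v mod 2
      else (v div 2 mod 2 + v mod 2) mod 2)" for i v :: nat
  define h where
    "h u v = (if g 0 u = g 0 v then 0 else if g 1 u = g 1 v then 1 else 2 :: nat)" for u v :: nat
  show ?thesis
  proof (rule f_max_lower[of n h g])
    fix u v :: nat assume "u < v" "v < n"
    show "h u v < 3" by (simp add: h_def)
    have xor: "(a + b) mod 2 = (a' + b') mod 2"
      if "a < 2" "b < 2" "a' < 2" "b' < 2" "a \<noteq> a'" "b \<noteq> b'" for a b a' b' :: nat
      using that by presburger
    have "g 2 u = g 2 v" if "g 0 u \<noteq> g 0 v" "g 1 u \<noteq> g 1 v"
      using xor[of "u div 2 mod 2" "u mod 2" "v div 2 mod 2" "v mod 2"] that by (simp add: g_def)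
    then show "g (h u v) u = g (h u v) v"
      unfolding h_def by presburger
  next
    fix i a :: nat assume "i < 3" "a < 2"
    then have "i = 0 \<or> i = 1 \<or> i = 2" "a = 0 \<or> a = 1"
      by linarith+
    then consider "i = 0" "a = 0" | "i = 0" "a = 1" | "i = 1" "a = 0" | "i = 1" "a = 1"
      | "i = 2" "a = 0" | "i = 2" "a = 1" by metis
    then show "\<exists>u v. u < v \<and> v < n \<and> h u v = i \<and> g i u = a"
    proof cases
      case 1
      then have "0 < (1::nat) \<and> 1 < n \<and> h 0 1 = i \<and> g i 0 = a"
        using assms by (auto simp: h_def g_def)
      then show ?thesis by blast
    next
      case 2
      then have "2 < (3::nat) \<and> 3 < n \<and> h 2 3 = i \<and> g i 2 = a"
        using assms by (auto simp: h_def g_def)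
      then show ?thesis by blast
    next
      case 3
      then have "0 < (2::nat) \<and> 2 < n \<and> h 0 2 = i \<and> g i 0 = a"
        using assms by (auto simp: h_def g_def)
      then show ?thesis by blast
    next
      case 4
      then have "1 < (3::nat) \<and> 3 < n \<and> h 1 3 = i \<and> g i 1 = a"
        using assms by (auto simp: h_def g_def)
      then show ?thesis by blast
    next
      case 5
      then have "0 < (3::nat) \<and> 3 < n \<and> h 0 3 = i \<and> g i 0 = a"
        using assms by (auto simp: h_def g_def)
      then show ?thesis by blast
    next
      case 6
      then have "1 < (2::nat) \<and> 2 < n \<and> h 1 2 = i \<and> g i 1 = a"
        using assms by (auto simp: h_def g_def)
      then show ?thesis by blast
    qed
  qed
qed

section \<open>The values\<close>

theorem theorem1p1:
  shows "f_max 4 3 = 2 \<and> f_max 5 3 = 2 \<and>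
    (\<forall>n::nat. 3 \<le> n \<and> n \<notin> {4, 5} \<longrightarrow> f_max n 3 = n div 6 + 1)"
proof (intro conjI allI impI)
  show "f_max 4 3 = 2"
    using f_max_lower_4_5[of 4] f_max_le_half[of 4] by linarith
  show "f_max 5 3 = 2"
    using f_max_lower_4_5[of 5] f_max_le_half[of 5] by linarith
next
  fix n :: nat assume n: "3 \<le> n \<and> n \<notin> {4, 5}"
  then consider "n = 3" | "6 \<le> n" by force
  then have "f_max n 3 \<le> n div 6 + 1"
  proof cases
    case 1
    then show ?thesis using f_max_le_half[of n] by linarith
  next
    case 2
    then have "1 \<le> n div 6" by linarith
    then show ?thesis using f_max_upper[of n] by linarith
  qed
  then show "f_max n 3 = n div 6 + 1"
    using f_max_lower_general[of n] n by linarith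
qed

end
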